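(* Let $J\in\mathcal{Z}$ be an arbitrary orthogonal almost complex structure. Then there exist $\varphi,\psi,\theta\in[-\pi/2,\pi/2]$ and $\varphi_1,\varphi_2,\varphi_3\in[0,2\pi]$ such that, writing $\alpha=\frac{\psi+\theta}{2}$ and $\beta=\frac{\psi-\theta}{2}$, the components $J_{ij}=g(Je_i,e_j)$ (with $J_{ji}=-J_{ij}$) of $J$ in the basis $(e)$ are $$\begin{array}{l} J_{12}=\sin\alpha\sin\beta(\cos\varphi_1\cos\varphi_2-\sin\varphi\sin\varphi_1\sin\varphi_2)+\cos\alpha\cos\beta(\sin\varphi_1\sin\varphi_2-\sin\varphi\cos\varphi_1\cos\varphi_2),\\ J_{13}=\cos\varphi(\cos\beta\cos\varphi_1\cos\varphi_3-\sin\alpha\sin\varphi_1\sin\varphi_3),\\ J_{14}=\sin\varphi\sin\alpha\cos\beta+\cos\alpha\sin\beta,\\ J_{15}=\cos\alpha\cos\beta(\sin\varphi\cos\varphi_1\sin\varphi_2+\sin\varphi_1\cos\varphi_2)-\sin\alpha\sin\beta(\sin\varphi\sin\varphi_1\cos\varphi_2+\cos\varphi_1\sin\varphi_2),\\ J_{16}=-\cos\varphi(\sin\alpha\sin\varphi_1\cos\varphi_3+\cos\beta\cos\varphi_1\sin\varphi_3),\\ J_{23}=\cos\varphi(\cos\alpha\cos\varphi_2\sin\varphi_3+\sin\beta\sin\varphi_2\cos\varphi_3),\\ J_{24}=\sin\alpha\sin\beta(\sin\varphi_1\cos\varphi_2+\sin\varphi\cos\varphi_1\sin\varphi_2)-\cos\alpha\cos\beta(\sin\varphi\sin\varphi_1\cos\varphi_2+\cos\varphi_1\sin\varphi_2),\\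 J_{25}=\sin\varphi\cos\alpha\sin\beta+\cos\beta\sin\alpha,\\ J_{26}=\cos\varphi(\cos\alpha\cos\varphi_2\cos\varphi_3-\sin\beta\sin\varphi_2\sin\varphi_3),\\ J_{34}=\cos\varphi(\sin\alpha\cos\varphi_1\sin\varphi_3+\cos\beta\sin\varphi_1\cos\varphi_3),\\ J_{35}=\cos\varphi(\cos\alpha\sin\varphi_2\sin\varphi_3-\sin\beta\cos\varphi_2\cos\varphi_3),\\ J_{36}=\sin\varphi,\\ J_{45}=\cos\alpha\cos\beta(\cos\varphi_1\cos\varphi_2-\sin\varphi\sin\varphi_1\sin\varphi_2)-\sin\alpha\sin\beta(\sin\varphi\cos\varphi_1\cos\varphi_2-\sin\varphi_1\sin\varphi_2),\\ J_{46}=\cos\varphi(\cos\beta\sin\varphi_1\sin\varphi_3-\sin\alpha\cos\varphi_1\cos\varphi_3),\\ J_{56}=-\cos\varphi(\cos\alpha\sin\varphi_2\cos\varphi_3+\sin\beta\cos\varphi_2\sin\varphi_3). \end{array}$$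
   Context: Let $G$ be a 6-dimensional Lie group with Lie algebra $\mathfrak{g}$ and a left-invariant Riemannian metric $g$. Left-invariant almost complex structures on $G$ are identified with endomorphisms $I$ of $\mathfrak{g}$ with $I^2=-1$; $I$ is orthogonal if $g(IX,IY)=g(X,Y)$. Fix a $g$-orthonormal basis $(e)=(e_1,\dots,e_6)$ of $\mathfrak{g}$. Let $I_0$ be given by $I_0e_1=e_4$, $I_0e_2=e_5$, $I_0e_3=e_6$ (and $I_0^2=-1$), and let $\mathcal{Z}=\{SI_0S^{-1}: S\in SO(6)\}$ be the set of orthogonal almost complex structures inducing the same orientation as $I_0$. The components $J_{ij}=g(Je_i,e_j)=\omega(e_i,e_j)$ are those of the fundamental 2-form $\omega(X,Y)=g(JX,Y)$. *)

theory Defs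
  imports "HOL-Analysis.Analysis"
begin

text \<open>
  The Lie algebra is a type of class \<open>euclidean_space\<close>, whose inner product \<open>\<bullet>\<close> is the metric
  \<open>g\<close>. Bases are indexed by the six-element type \<open>6\<close>, whose elements are \<open>1, \<dots>, 6\<close>
  (with \<open>6 = 0\<close>).
\<close>

definition lie_bracket :: "('a::real_vector \<Rightarrow> 'a \<Rightarrow> 'a) \<Rightarrow> bool" where
  "lie_bracket br \<longleftrightarrow> bilinear br \<and> (\<forall>x. br x x = 0) \<and>
     (\<forall>x y z. br x (br y z) + br y (br z x) + br z (br x y) = 0)"

definition orthonormal_basis :: "('n::finite \<Rightarrow> 'a::euclidean_space) \<Rightarrow> bool" where
  "orthonormal_basis e \<longleftrightarrow>
     (\<forall>i j. e i \<bullet> e j = (if i = j then 1 else 0)) \<and> span (range e) = UNIV"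

definition almost_complex :: "('a::real_vector \<Rightarrow> 'a) \<Rightarrow> bool" where
  "almost_complex I \<longleftrightarrow> linear I \<and> (\<forall>x. I (I x) = - x)"

definition orthogonal_acs :: "('a::euclidean_space \<Rightarrow> 'a) \<Rightarrow> bool" where
  "orthogonal_acs I \<longleftrightarrow> almost_complex I \<and> (\<forall>x y. I x \<bullet> I y = x \<bullet> y)"

text \<open>
  The determinant of an endomorphism is that of its matrix in the orthonormal basis \<open>e\<close>; it does
  not depend on the choice of \<open>e\<close>.
\<close>

definition special_orthogonal ::
    "('n::finite \<Rightarrow> 'a::euclidean_space) \<Rightarrow> ('a \<Rightarrow> 'a) set" where
  "special_orthogonal e =
     {S. orthogonal_transformation S \<and> det (\<chi> i j. e i \<bullet> S (e j)) = 1}"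

definition acs_orbit ::
    "('n::finite \<Rightarrow> 'a::euclidean_space) \<Rightarrow> ('a \<Rightarrow> 'a) \<Rightarrow> ('a \<Rightarrow> 'a) set" where
  "acs_orbit e I0 = {S \<circ> I0 \<circ> inv S | S. S \<in> special_orthogonal e}"

lemma UNIV_6: "(UNIV :: 6 set) = {1, 2, 3, 4, 5, 6}"
proof -
  have "card {1, 2, 3, 4, 5, 6 :: 6} = CARD(6)" by simp
  then show ?thesis by (metis card_subset_eq finite subset_UNIV)
qed

lemma standard_acs_unique:
  fixes e :: "6 \<Rightarrow> 'a::euclidean_space"
  assumes "orthonormal_basis e"
  shows "\<exists>!I0. almost_complex I0 \<and> I0 (e 1) = e 4 \<and> I0 (e 2) = e 5 \<and> I0 (e 3) = e 6"
proof -
  have ip: "\<And>i j. e i \<bullet> e j = (if i = j then 1 else 0)" and sp: "span (range e) = UNIV"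
    using assms by (auto simp: orthonormal_basis_def)
  define I where "I = (\<lambda>x. (x \<bullet> e 1) *\<^sub>R e 4 + (x \<bullet> e 2) *\<^sub>R e 5 + (x \<bullet> e 3) *\<^sub>R e 6
      - (x \<bullet> e 4) *\<^sub>R e 1 - (x \<bullet> e 5) *\<^sub>R e 2 - (x \<bullet> e 6) *\<^sub>R e 3)"
  have lin: "linear I"
    by (rule linearI) (simp_all add: I_def algebra_simps)
  have Ie: "I (e 1) = e 4" "I (e 2) = e 5" "I (e 3) = e 6"
      "I (e 4) = - e 1" "I (e 5) = - e 2" "I (e 6) = - e 3"
    by (simp_all add: I_def ip)
  have "I (I x) = - x" for x
  proof -
    have "(I \<circ> I) x = - x"
    proof (rule linear_eq_on[where f = "I \<circ> I" and g = uminus and B = "range e"])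
      show "linear (I \<circ> I)" using lin by (intro linear_compose)
      show "linear (uminus :: 'a \<Rightarrow> 'a)" by (rule linearI) simp_all
      show "x \<in> span (range e)" using sp by simp
      fix b assume "b \<in> range e"
      then show "(I \<circ> I) b = - b"
        using linear_neg[OF lin] by (auto simp: UNIV_6 Ie)
    qed
    then show ?thesis by simp
  qed
  then have ex: "almost_complex I" using lin by (simp add: almost_complex_def)
  have uniq: "K = I" if K: "almost_complex K" "K (e 1) = e 4" "K (e 2) = e 5" "K (e 3) = e 6" for K
  proof
    fix x
    have Klin: "linear K" and KK: "\<And>x. K (K x) = - x"
      using K(1) by (auto simp: almost_complex_def)
    have Ke: "K (e 4) = - e 1" "K (e 5) = - e 2" "K (e 6) = - e 3"
      using KK[of "e 1"] KK[of "e 2"] KK[of "e 3"] K by simp_all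
    show "K x = I x"
    proof (rule linear_eq_on[where f = K and g = I and B = "range e"])
      fix b assume "b \<in> range e"
      then show "K b = I b" by (auto simp: UNIV_6 Ie Ke K)
    qed (use Klin lin sp in simp_all)
  qed
  show ?thesis
  proof (rule ex1I[of _ I])
    show "almost_complex I \<and> I (e 1) = e 4 \<and> I (e 2) = e 5 \<and> I (e 3) = e 6"
      using ex Ie by simp
  qed (use uniq in blast)
qed

lemma standard_acs_orthogonal:
  fixes e :: "6 \<Rightarrow> 'a::euclidean_space"
  assumes e: "orthonormal_basis e" and I0: "almost_complex I0"
    and "I0 (e 1) = e 4" "I0 (e 2) = e 5" "I0 (e 3) = e 6"
  shows "orthogonal_acs I0"
proof -
  have ip: "\<And>i j. e i \<bullet> e j = (if i = j then 1 else 0)" and sp: "span (range e) = UNIV"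
    using e by (auto simp: orthonormal_basis_def)
  have lin: "linear I0" and sq: "\<And>x. I0 (I0 x) = - x"
    using I0 by (auto simp: almost_complex_def)
  have Ie: "I0 (e 4) = - e 1" "I0 (e 5) = - e 2" "I0 (e 6) = - e 3"
    using sq[of "e 1"] sq[of "e 2"] sq[of "e 3"] assms by simp_all
  have "I0 x \<bullet> I0 y = x \<bullet> y" for x y
  proof (rule bilinear_eq[where f = "\<lambda>x y. I0 x \<bullet> I0 y" and g = "(\<bullet>)"
        and S = UNIV and T = UNIV and B = "range e" and C = "range e"])
    show "bilinear (\<lambda>x y. I0 x \<bullet> I0 y)"
      unfolding bilinear_def
      by (auto intro!: linearI
          simp: linear_add[OF lin] linear_cmul[OF lin] inner_add_left inner_add_right)
    show "bilinear ((\<bullet>) :: 'a \<Rightarrow> 'a \<Rightarrow> real)"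
      unfolding bilinear_def by (auto intro!: linearI simp: inner_add_left inner_add_right)
    fix b c assume "b \<in> range e" "c \<in> range e"
    then obtain i j where bc: "b = e i" "c = e j" by blast
    have "i \<in> {1, 2, 3, 4, 5, 6}" "j \<in> {1, 2, 3, 4, 5, 6}"
      unfolding UNIV_6[symmetric] by simp_all
    then show "I0 b \<bullet> I0 c = b \<bullet> c"
      unfolding bc insert_iff empty_iff by (elim disjE) (simp_all add: Ie assms(3-5) ip)
  qed (simp_all add: sp)
  then show ?thesis using I0 by (simp add: orthogonal_acs_def)
qed

lemma acs_orbit_orthogonal:
  fixes e :: "'n::finite \<Rightarrow> 'a::euclidean_space"
  assumes I0: "orthogonal_acs I0" and J: "J \<in> acs_orbit e I0"
  shows "orthogonal_acs J"
proof -
  obtain S where S: "orthogonal_transformation S" and JS: "J = S \<circ> I0 \<circ> inv S"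
    using J by (auto simp: acs_orbit_def special_orthogonal_def)
  have T: "orthogonal_transformation (inv S)" and bij: "bij S"
    using S orthogonal_transformation_inv orthogonal_transformation_bij by blast+
  have lin: "linear I0" "linear S" "linear (inv S)"
    using I0 S T by (auto simp: orthogonal_acs_def almost_complex_def orthogonal_transformation_def)
  have "linear J" unfolding JS using lin by (intro linear_compose)
  moreover have "J (J x) = - x" for x
    using I0 bij linear_neg[OF lin(2)]
    by (simp add: JS orthogonal_acs_def almost_complex_def bij_is_inj bij_is_surj surj_f_inv_f)
  moreover have "J x \<bullet> J y = x \<bullet> y" for x y
    using I0 S T by (simp add: JS orthogonal_acs_def orthogonal_transformation_def)
  ultimately show ?thesis by (simp add: orthogonal_acs_def almost_complex_def)
qed

end

theory Submission
  imports Defs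
begin

text \<open>
  Let \<open>a\<close> be the matrix of \<open>J\<close> in the basis \<open>e\<close>. It is skew and orthogonal, and its Pfaffian is
  \<open>-1\<close> because \<open>J\<close> is conjugate to \<open>I0\<close> by an element of determinant \<open>1\<close>. The expansion of the
  Pfaffian then identifies each entry of \<open>a\<close>, up to sign, with the Pfaffian of the complementary
  \<open>4 \<times> 4\<close> block.

  Under the isomorphism of \<open>\<Lambda>\<^sup>2 \<real>\<^sup>6\<close> with \<open>su(4)\<close>, these relations say that a Hermitian
  \<open>4 \<times> 4\<close> matrix of trace \<open>1\<close>, whose entries are affine in those of \<open>a\<close>, has rank one and so equals
  \<open>z z\<^sup>*\<close> for a unit vector \<open>z\<close>: this is the identification of the twistor fibre with complex
  projective 3-space. The moduli of the four coordinates of \<open>z\<close> give \<open>\<phi>, \<psi>, \<theta>\<close> and their phases,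
  up to a common one, give \<open>\<phi>\<^sub>1, \<phi>\<^sub>2, \<phi>\<^sub>3\<close>.
\<close>

subsection \<open>Pfaffians of size 4 and 6\<close>

text \<open>Pfaffian of the block on the listed indices, taken in the listed order; only entries
  whose first index precedes the second in the list occur. \<open>pf6\<close> below is its expansion
  along the row of the first index.\<close>

definition pf4 :: "('n \<Rightarrow> 'n \<Rightarrow> 'b::comm_ring_1) \<Rightarrow> 'n \<Rightarrow> 'n \<Rightarrow> 'n \<Rightarrow> 'n \<Rightarrow> 'b" where
  "pf4 a i j k l = a i j * a k l - a i k * a j l + a i l * a j k"

definition pf6 :: "('n \<Rightarrow> 'n \<Rightarrow> 'b::comm_ring_1) \<Rightarrow> 'n \<Rightarrow> 'n \<Rightarrow> 'n \<Rightarrow> 'n \<Rightarrow> 'n \<Rightarrow> 'n \<Rightarrow> 'b" where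
  "pf6 a i j k l m n = a i j * pf4 a k l m n - a i k * pf4 a j l m n + a i l * pf4 a j k m n
     - a i m * pf4 a j k l n + a i n * pf4 a j k l m"

lemma sum_6: "sum f (UNIV::6 set) = f 1 + f 2 + f 3 + f 4 + f 5 + f 6"
  unfolding UNIV_6 by (simp add: ac_simps)

lemma forall_6: "(\<forall>i::6. P i) \<longleftrightarrow> P 1 \<and> P 2 \<and> P 3 \<and> P 4 \<and> P 5 \<and> P 6"
  by (metis (full_types) UNIV_6 UNIV_I empty_iff insert_iff)

text \<open>Rewrite rules that bring every entry above the diagonal, so that polynomial identities
  in the entries can be decided by normalisation.\<close>

lemma skew_6:
  fixes a :: "6 \<Rightarrow> 6 \<Rightarrow> real"
  assumes "\<And>p q. a q p = - a p q"
  shows "a 2 1 = - a 1 2" "a 3 1 = - a 1 3" "a 4 1 = - a 1 4" "a 5 1 = - a 1 5" "a 6 1 = - a 1 6"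
    "a 3 2 = - a 2 3" "a 4 2 = - a 2 4" "a 5 2 = - a 2 5" "a 6 2 = - a 2 6"
    "a 4 3 = - a 3 4" "a 5 3 = - a 3 5" "a 6 3 = - a 3 6"
    "a 5 4 = - a 4 5" "a 6 4 = - a 4 6" "a 6 5 = - a 5 6" "a p p = 0"
proof -
  show "a p p = 0" using assms[of p p] by simp
qed (rule assms)+

text \<open>A skew matrix times its Pfaffian adjugate is the Pfaffian times the identity. For an
  orthogonal matrix the inverse is the transpose, so each Pfaffian cofactor is a multiple of the
  matching entry.\<close>

lemma pf4_eq_pf6:
  fixes a :: "'n::finite \<Rightarrow> 'n \<Rightarrow> real"
  assumes skew: "\<And>p q. a q p = - a p q"
    and orth: "\<And>p q. (\<Sum>r\<in>UNIV. a p r * a q r) = of_bool (p = q)"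
    and "distinct [i, j, k, l, m, n]" and "UNIV = {i, j, k, l, m, n}"
  shows "pf4 a k l m n = a i j * pf6 a i j k l m n"
proof -
  define N where "N p q = a p i * a q i + a p j * a q j + a p k * a q k + a p l * a q l
    + a p m * a q m + a p n * a q n" for p q
  have N: "N p q = of_bool (p = q)" for p q
    using orth[of p q] assms(3) unfolding N_def assms(4) by (simp add: ac_simps)
  have diag: "a p p = 0" for p using skew[of p p] by simp
  have sk: "a j i = - a i j" "a k i = - a i k" "a l i = - a i l" "a m i = - a i m" "a n i = - a i n"
    "a k j = - a j k" "a l j = - a j l" "a m j = - a j m" "a n j = - a j n"
    "a l k = - a k l" "a m k = - a k m" "a n k = - a k n"
    "a m l = - a l m" "a n l = - a l n" "a n m = - a m n"
    by (rule skew)+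
  \<comment> \<open>column \<open>j\<close> of \<open>a * adj = pf * 1\<close> for the Pfaffian adjugate, multiplied by row \<open>i\<close> of \<open>a\<close>\<close>
  have "a i j * pf6 a i j k l m n = pf4 a k l m n * N i i - pf4 a i l m n * N i k
      + pf4 a i k m n * N i l - pf4 a i k l n * N i m + pf4 a i k l m * N i n"
    unfolding N_def pf6_def pf4_def by (simp add: diag sk algebra_simps)
  then show ?thesis using assms(3) by (simp add: N)
qed

text \<open>For i < j the sign is (-1)^(i+j): moving i and j to the front is a permutation of sign
  (-1)^(i+j+1), which is the \<open>\<epsilon>\<close> of the proof, and the Pfaffian contributes
  the factor -1.\<close>

lemma complementary_pf4:
  fixes a :: "6 \<Rightarrow> 6 \<Rightarrow> real"
  assumes skew: "\<And>p q. a q p = - a p q"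
    and orth: "\<And>p q. (\<Sum>r\<in>UNIV. a p r * a q r) = of_bool (p = q)"
    and pf: "pf6 a 1 2 3 4 5 6 = -1"
  shows "pf4 a 3 4 5 6 = - a 1 2" "pf4 a 2 4 5 6 = a 1 3" "pf4 a 2 3 5 6 = - a 1 4"
    "pf4 a 2 3 4 6 = a 1 5" "pf4 a 2 3 4 5 = - a 1 6" "pf4 a 1 4 5 6 = - a 2 3"
    "pf4 a 1 3 5 6 = a 2 4" "pf4 a 1 3 4 6 = - a 2 5" "pf4 a 1 3 4 5 = a 2 6"
    "pf4 a 1 2 5 6 = - a 3 4" "pf4 a 1 2 4 6 = a 3 5" "pf4 a 1 2 4 5 = - a 3 6"
    "pf4 a 1 2 3 6 = - a 4 5" "pf4 a 1 2 3 5 = a 4 6" "pf4 a 1 2 3 4 = - a 5 6"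
proof -
  note sk = skew_6[of a, OF skew]
  have *: "pf4 a k l m n = - \<epsilon> * a i j"
    if "pf6 a i j k l m n = \<epsilon> * pf6 a 1 2 3 4 5 6"
      "distinct [i, j, k, l, m, n]" for i j k l m n \<epsilon>
  proof -
    have "set [i, j, k, l, m, n] = UNIV"
      using distinct_card[OF that(2)] by (intro card_subset_eq) simp_all
    then show ?thesis
      using pf4_eq_pf6[of a i j k l m n, OF skew orth that(2)] that(1) pf by simp
  qed
  note d = pf6_def pf4_def sk algebra_simps
  have "pf4 a 3 4 5 6 = - 1 * a 1 2" by (rule *) (simp_all add: d)
  then show "pf4 a 3 4 5 6 = - a 1 2" by simp
  have "pf4 a 2 4 5 6 = - (- 1) * a 1 3" by (rule *) (simp_all add: d)
  then show "pf4 a 2 4 5 6 = a 1 3" by simp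
  have "pf4 a 2 3 5 6 = - 1 * a 1 4" by (rule *) (simp_all add: d)
  then show "pf4 a 2 3 5 6 = - a 1 4" by simp
  have "pf4 a 2 3 4 6 = - (- 1) * a 1 5" by (rule *) (simp_all add: d)
  then show "pf4 a 2 3 4 6 = a 1 5" by simp
  have "pf4 a 2 3 4 5 = - 1 * a 1 6" by (rule *) (simp_all add: d)
  then show "pf4 a 2 3 4 5 = - a 1 6" by simp
  have "pf4 a 1 4 5 6 = - 1 * a 2 3" by (rule *) (simp_all add: d)
  then show "pf4 a 1 4 5 6 = - a 2 3" by simp
  have "pf4 a 1 3 5 6 = - (- 1) * a 2 4" by (rule *) (simp_all add: d)
  then show "pf4 a 1 3 5 6 = a 2 4" by simp
  have "pf4 a 1 3 4 6 = - 1 * a 2 5" by (rule *) (simp_all add: d)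
  then show "pf4 a 1 3 4 6 = - a 2 5" by simp
  have "pf4 a 1 3 4 5 = - (- 1) * a 2 6" by (rule *) (simp_all add: d)
  then show "pf4 a 1 3 4 5 = a 2 6" by simp
  have "pf4 a 1 2 5 6 = - 1 * a 3 4" by (rule *) (simp_all add: d)
  then show "pf4 a 1 2 5 6 = - a 3 4" by simp
  have "pf4 a 1 2 4 6 = - (- 1) * a 3 5" by (rule *) (simp_all add: d)
  then show "pf4 a 1 2 4 6 = a 3 5" by simp
  have "pf4 a 1 2 4 5 = - 1 * a 3 6" by (rule *) (simp_all add: d)
  then show "pf4 a 1 2 4 5 = - a 3 6" by simp
  have "pf4 a 1 2 3 6 = - 1 * a 4 5" by (rule *) (simp_all add: d)
  then show "pf4 a 1 2 3 6 = - a 4 5" by simp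
  have "pf4 a 1 2 3 5 = - (- 1) * a 4 6" by (rule *) (simp_all add: d)
  then show "pf4 a 1 2 3 5 = a 4 6" by simp
  have "pf4 a 1 2 3 4 = - 1 * a 5 6" by (rule *) (simp_all add: d)
  then show "pf4 a 1 2 3 4 = - a 5 6" by simp
qed

subsection \<open>The Pfaffian under congruence\<close>

text \<open>Congruence by a transposition matrix. Quantifying over both indices lets
  \<open>forall_6\<close> split the claim into concrete polynomial identities.\<close>

lemma pf6_transpose:
  fixes a :: "6 \<Rightarrow> 6 \<Rightarrow> real"
  assumes "\<And>p q. a q p = - a p q" and "m \<noteq> n"
  defines "t \<equiv> Transposition.transpose m n"
  shows "pf6 (\<lambda>i j. a (t i) (t j)) 1 2 3 4 5 6 = - pf6 a 1 2 3 4 5 6"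
proof -
  have "\<forall>m n. m \<noteq> n \<longrightarrow> pf6 (\<lambda>i j. a (Transposition.transpose m n i) (Transposition.transpose m n j))
      1 2 3 4 5 6 = - pf6 a 1 2 3 4 5 6"
    unfolding forall_6
    by (intro conjI impI; simp add: pf6_def pf4_def Transposition.transpose_def
          skew_6[of a, OF assms(1)]; simp add: algebra_simps)
  then show ?thesis using assms(2) unfolding t_def by blast
qed

text \<open>Congruence by a transvection: row n is added to row m and column n to column m. The
  quadratic term at position (m, m) would be \<open>a n n\<close>, which is zero by
  skewness.\<close>

lemma pf6_transvection:
  fixes a :: "6 \<Rightarrow> 6 \<Rightarrow> real"
  assumes "\<And>p q. a q p = - a p q" and "m \<noteq> n"
  shows "pf6 (\<lambda>i j. a i j + of_bool (i = m) * a n j + of_bool (j = m) * a i n) 1 2 3 4 5 6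
    = pf6 a 1 2 3 4 5 6"
proof -
  have "\<forall>m n. m \<noteq> n \<longrightarrow> pf6 (\<lambda>i j. a i j + of_bool (i = m) * a n j + of_bool (j = m) * a i n)
      1 2 3 4 5 6 = pf6 a 1 2 3 4 5 6"
    unfolding forall_6
    by (intro conjI impI; simp add: pf6_def pf4_def skew_6[of a, OF assms(1)];
          simp add: algebra_simps)
  then show ?thesis using assms(2) by blast
qed

lemma congruence_nth:
  "(A ** M ** transpose A) $ i $ j = (\<Sum>k\<in>UNIV. \<Sum>l\<in>UNIV. A $ i $ k * M $ k $ l * A $ j $ l)"
  for A M :: "'b::comm_semiring_1^'n^'n"
  unfolding matrix_matrix_mult_def transpose_def
  by (simp add: sum_distrib_right) (rule sum.swap)

lemma skew_congruence:
  fixes A M :: "real^'n^'n"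
  assumes "transpose M = - M"
  shows "transpose (A ** M ** transpose A) = - (A ** M ** transpose A)"
proof -
  have "transpose (A ** M ** transpose A) = A ** (- M) ** transpose A"
    by (simp add: matrix_transpose_mul assms matrix_mul_assoc)
  also have "\<dots> = - (A ** M ** transpose A)"
    by (simp add: vec_eq_iff congruence_nth sum_negf)
  finally show ?thesis .
qed

definition pfaffian :: "real^6^6 \<Rightarrow> real" where
  "pfaffian M = pf6 (\<lambda>i j. M $ i $ j) 1 2 3 4 5 6"

lemma skew_nth:
  fixes M :: "real^'n^'n"
  assumes "transpose M = - M"
  shows "M $ q $ p = - M $ p $ q"
  using arg_cong[OF assms, of "\<lambda>N. N $ p $ q"] by (simp add: transpose_def)

text \<open>Entry (i, j) is scaled by \<open>D i * D j\<close>, and every monomial of the Pfaffian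
  uses each of the six indices exactly once.\<close>

lemma pfaffian_congruence_diagonal:
  fixes A M :: "real^6^6"
  assumes d: "\<And>i j. i \<noteq> j \<Longrightarrow> A $ i $ j = 0"
  shows "pfaffian (A ** M ** transpose A) = det A * pfaffian M"
proof -
  define D where "D i = A $ i $ i" for i
  have A: "A $ i $ k = (if k = i then D i else 0)" for i k using d by (auto simp: D_def)
  have B: "(A ** M ** transpose A) $ i $ j = D i * M $ i $ j * D j" for i j
    unfolding congruence_nth by (simp add: A mult_delta_left mult_delta_right)
  have "det A = (\<Prod>i\<in>UNIV. D i)"
    unfolding D_def by (rule det_diagonal) (rule d)
  also have "\<dots> = D 1 * D 2 * D 3 * D 4 * D 5 * D 6"
    unfolding UNIV_6 by (simp add: mult.assoc)
  finally show ?thesis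
    unfolding pfaffian_def B pf6_def pf4_def by (simp add: algebra_simps)
qed

lemma pfaffian_congruence_swap:
  fixes M :: "real^6^6" and m n :: 6
  assumes M: "transpose M = - M" and mn: "m \<noteq> n"
  defines "A \<equiv> (\<chi> i j. mat 1 $ i $ Transposition.transpose m n j) :: real^6^6"
  shows "pfaffian (A ** M ** transpose A) = det A * pfaffian M"
proof -
  define t where "t = Transposition.transpose m n"
  have A: "A = (\<chi> i j. mat 1 $ i $ t j)" unfolding A_def t_def ..
  have *: "mat 1 $ i $ t k = (if k = t i then 1 else 0 :: real)" for i k
    unfolding mat_def vec_lambda_beta t_def by (metis transpose_involutory)
  have nth: "(A ** M ** transpose A) $ i $ j = M $ t i $ t j" for i j
    unfolding congruence_nth A vec_lambda_beta *
    by (simp add: mult_delta_left mult_delta_right)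
  \<comment> \<open>As \<open>t\<close> is an involution, permuting the columns of the identity by
    \<open>t\<close> is the same as permuting its rows.\<close>
  have "A = (\<chi> i. mat 1 $ t i)"
    unfolding vec_eq_iff vec_lambda_beta A * by (simp add: mat_def eq_commute)
  then have "det A = -1"
    using det_permute_rows[of t "mat 1 :: real^6^6"] mn
    by (simp add: permutes_swap_id sign_swap_id t_def)
  then show ?thesis
    unfolding pfaffian_def nth t_def using pf6_transpose[OF skew_nth[OF M] mn] by simp
qed

lemma pfaffian_congruence_transvection:
  fixes M :: "real^6^6" and m n :: 6
  assumes M: "transpose M = - M" and mn: "m \<noteq> n"
  defines "A \<equiv> (\<chi> i j. of_bool (i = m \<and> j = n \<or> i = j)) :: real^6^6"
  shows "pfaffian (A ** M ** transpose A) = det A * pfaffian M"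
proof -
  have *: "A $ i $ j = (if j = i then 1 else 0) + (if j = n then of_bool (i = m) else 0)" for i j
    using mn by (auto simp: A_def)
  have nth: "(A ** M ** transpose A) $ i $ j
      = M $ i $ j + of_bool (i = m) * M $ n $ j + of_bool (j = m) * M $ i $ n" for i j
    unfolding congruence_nth * distrib_left distrib_right sum.distrib
    using skew_nth[OF M, of n n] by (simp add: mult_delta_left mult_delta_right)
  have "A = (\<chi> k. if k = m then row m (mat 1) + 1 *s row n (mat 1) else row k (mat 1))"
    using mn by (simp add: vec_eq_iff mat_def row_def A_def)
  then have "det A = 1"
    by (simp only: det_row_operation[OF mn] det_I)
  then show ?thesis
    unfolding pfaffian_def nth using pf6_transvection[OF skew_nth[OF M] mn] by simp
qed

text \<open>Induction over products of elementary matrices: \<open>det\<close> is multiplicative,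
  and a matrix with a zero row makes both sides vanish.\<close>

lemma pfaffian_congruence:
  fixes A M :: "real^6^6"
  assumes "transpose M = - M"
  shows "pfaffian (A ** M ** transpose A) = det A * pfaffian M"
proof -
  \<comment> \<open>\<open>M\<close> is quantified because in the product case the hypothesis for
    \<open>A\<close> is applied to \<open>B ** M ** transpose B\<close>, which is again
    skew.\<close>
  have "\<forall>M. transpose M = - M \<longrightarrow> pfaffian (A ** M ** transpose A) = det A * pfaffian M" (is "?P A")
  proof (rule induct_matrix_elementary_alt[of ?P])
    fix A B assume A: "?P A" and B: "?P B"
    show "?P (A ** B)"
    proof (intro allI impI)
      fix M :: "real^6^6" assume M: "transpose M = - M"
      have "A ** B ** M ** transpose (A ** B) = A ** (B ** M ** transpose B) ** transpose A"
        by (simp add: matrix_transpose_mul matrix_mul_assoc)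
      then show "pfaffian (A ** B ** M ** transpose (A ** B)) = det (A ** B) * pfaffian M"
        using A B M skew_congruence[OF M, of B] by (simp add: det_mul)
    qed
  next
    fix A :: "real^6^6" and i assume r: "row i A = 0"
    have 0: "A $ i $ k = 0" for k
      using r by (simp add: row_def vec_eq_iff)
    have "(A ** M ** transpose A) $ i $ j = 0" "(A ** M ** transpose A) $ j $ i = 0" for M j
      by (simp_all add: congruence_nth 0)
    moreover have "\<forall>i::6. (\<forall>j. B $ i $ j = 0 \<and> B $ j $ i = 0) \<longrightarrow> pfaffian B = 0" for B :: "real^6^6"
      unfolding forall_6[of "\<lambda>i. _ i \<longrightarrow> _"] by (simp add: pfaffian_def pf6_def pf4_def)
    ultimately have "pfaffian (A ** M ** transpose A) = 0" for M by blast
    then show "?P A" using det_zero_row(2)[OF r] by simp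
  next
    fix A :: "real^6^6" assume d: "\<And>i j. i \<noteq> j \<Longrightarrow> A $ i $ j = 0"
    show "?P A" using pfaffian_congruence_diagonal d by blast
  next
    fix m n :: 6 assume "m \<noteq> n"
    then show "?P (\<chi> i j. mat 1 $ i $ Transposition.transpose m n j)"
      by (intro allI impI pfaffian_congruence_swap)
  next
    fix m n :: 6 assume "m \<noteq> n"
    then show "?P (\<chi> i j. of_bool (i = m \<and> j = n \<or> i = j))"
      by (intro allI impI pfaffian_congruence_transvection)
  qed
  then show ?thesis using assms by blast
qed

subsection \<open>The matrix of an orthogonal almost complex structure\<close>

text \<open>Parseval's identity: the coordinate expansion \<open>S\<close> is linear and fixes every
  basis vector, hence is the identity.\<close>

lemma orthonormal_basis_inner:
  fixes e :: "'n::finite \<Rightarrow> 'a::euclidean_space"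
  assumes "orthonormal_basis e"
  shows "(\<Sum>k\<in>UNIV. (x \<bullet> e k) * (y \<bullet> e k)) = x \<bullet> y"
proof -
  have ip: "e i \<bullet> e j = (if i = j then 1 else 0)" and sp: "span (range e) = UNIV" for i j
    using assms by (auto simp: orthonormal_basis_def)
  define S where "S x = (\<Sum>k\<in>UNIV. (x \<bullet> e k) *\<^sub>R e k)" for x
  have lin: "linear S"
    by (rule linearI) (simp_all add: S_def inner_add_left scaleR_add_left sum.distrib scaleR_sum_right)
  have "S (e i) = e i" for i
    unfolding S_def ip by (simp add: if_distrib[of "\<lambda>c. c *\<^sub>R _"] cong: if_cong)
  then have "S x = id x"
    using lin sp by (intro linear_eq_on[of S id x "range e"]) (auto simp: linear_id)
  then have "x \<bullet> y = (\<Sum>k\<in>UNIV. (x \<bullet> e k) *\<^sub>R e k) \<bullet> y"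
    by (simp add: S_def)
  then show ?thesis
    unfolding inner_sum_left inner_scaleR_left by (simp add: inner_commute[of y])
qed

lemma orthogonal_acs_skew:
  assumes "orthogonal_acs J"
  shows "J y \<bullet> x = - (J x \<bullet> y)"
proof -
  have "J x \<bullet> y = J (J x) \<bullet> J y" using assms by (simp add: orthogonal_acs_def)
  also have "\<dots> = - (x \<bullet> J y)" using assms by (simp add: orthogonal_acs_def almost_complex_def)
  finally show ?thesis by (simp add: inner_commute)
qed

text \<open>The components of \<open>J\<close> are congruent to those of \<open>I0\<close> through
  the matrix of \<open>S\<close>, whose determinant is 1, so \<open>J\<close> has the Pfaffian of
  \<open>I0\<close>.\<close>

lemma acs_orbit_pfaffian:
  fixes e :: "6 \<Rightarrow> 'a::euclidean_space"
  assumes e: "orthonormal_basis e" and I0: "almost_complex I0"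
    and std: "I0 (e 1) = e 4" "I0 (e 2) = e 5" "I0 (e 3) = e 6"
    and J: "J \<in> acs_orbit e I0"
  shows "pf6 (\<lambda>i j. J (e i) \<bullet> e j) 1 2 3 4 5 6 = -1"
proof -
  obtain S where S: "orthogonal_transformation S" and JS: "J = S \<circ> I0 \<circ> inv S"
    and det: "det (\<chi> i j. e i \<bullet> S (e j)) = 1"
    using J by (auto simp: acs_orbit_def special_orthogonal_def)
  have ip: "e i \<bullet> e j = (if i = j then 1 else 0)" for i j
    using e by (auto simp: orthonormal_basis_def)
  have oI0: "orthogonal_acs I0" by (rule standard_acs_orthogonal[OF e I0 std])
  define A where "A = (\<chi> i j. e i \<bullet> S (e j))"
  define K where "K = (\<chi> i j. I0 (e i) \<bullet> e j)"
  have lin: "linear I0" and sq: "\<And>x. I0 (I0 x) = - x"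
    using I0 by (auto simp: almost_complex_def)
  have Ie: "I0 (e 4) = - e 1" "I0 (e 5) = - e 2" "I0 (e 6) = - e 3"
    using sq[of "e 1"] sq[of "e 2"] sq[of "e 3"] std by simp_all
  have skew: "transpose K = - K"
    unfolding vec_eq_iff K_def transpose_def
    by (simp add: orthogonal_acs_skew[OF oI0, symmetric])
  have T: "inv S x \<bullet> y = x \<bullet> S y" for x y
  proof -
    have "S (inv S x) = x"
      using orthogonal_transformation_surj[OF S] by (rule surj_f_inv_f)
    then show ?thesis using S unfolding orthogonal_transformation_def by metis
  qed
  \<comment> \<open>Parseval's identity collapses both sums over the basis; \<open>T\<close> says
    that \<open>S\<close> is the adjoint of its inverse.\<close>
  have "J (e i) \<bullet> e j = (A ** K ** transpose A) $ i $ j" for i j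
  proof -
    have 1: "(\<Sum>k\<in>UNIV. (I0 (e l) \<bullet> e k) * (e j \<bullet> S (e k))) = I0 (e l) \<bullet> inv S (e j)" for l
      using orthonormal_basis_inner[OF e, of "I0 (e l)" "inv S (e j)"] by (simp add: T)
    have "(A ** K ** transpose A) $ i $ j
        = (\<Sum>l\<in>UNIV. (e i \<bullet> S (e l)) * (I0 (e l) \<bullet> inv S (e j)))"
      unfolding congruence_nth A_def K_def 1[symmetric] by (simp add: sum_distrib_left mult.assoc)
    also have "\<dots> = - (\<Sum>l\<in>UNIV. (inv S (e i) \<bullet> e l) * (I0 (inv S (e j)) \<bullet> e l))"
      unfolding T using orthogonal_acs_skew[OF oI0, of _ "inv S (e j)"] by (simp add: sum_negf)
    also have "\<dots> = - (inv S (e i) \<bullet> I0 (inv S (e j)))"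
      unfolding orthonormal_basis_inner[OF e] ..
    also have "\<dots> = I0 (inv S (e i)) \<bullet> inv S (e j)"
      using orthogonal_acs_skew[OF oI0] by (metis inner_commute minus_minus)
    also have "\<dots> = J (e i) \<bullet> e j"
      unfolding JS by (metis T inner_commute comp_apply)
    finally show ?thesis by simp
  qed
  then have "pf6 (\<lambda>i j. J (e i) \<bullet> e j) 1 2 3 4 5 6 = pfaffian (A ** K ** transpose A)"
    by (simp add: pfaffian_def)
  also have "\<dots> = pfaffian K"
    using pfaffian_congruence[OF skew, of A] det by (simp add: A_def)
  \<comment> \<open>Only the matching {14, 25, 36} contributes, and the permutation 1 4 2 5 3 6 has
    three inversions.\<close>
  also have "\<dots> = -1"
    by (simp add: pfaffian_def K_def pf6_def pf4_def std Ie ip)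
  finally show ?thesis .
qed

subsection \<open>The spinor\<close>

text \<open>Trace 1 provides a positive diagonal entry \<open>h k k\<close>. Column k divided by the
  square root of that entry serves as \<open>z\<close>, because the minors through (k, k)
  vanish.\<close>

lemma rank_one_hermitian:
  fixes h :: "'n::finite \<Rightarrow> 'n \<Rightarrow> complex"
  assumes herm: "\<And>i j. h j i = cnj (h i j)" and tr: "(\<Sum>i\<in>UNIV. h i i) = 1"
    and minor: "\<And>i j k. h i k * h k j = h k k * h i j"
  obtains z where "\<And>i j. h i j = z i * cnj (z j)"
proof -
  have diag: "h i i = of_real (Re (h i i))" for i
    using herm[of i i] by (simp add: complex_eq_iff)
  have nn: "Re (h i i) * Re (h j j) \<ge> 0" for i j
  proof -
    have "h j j * h i i = of_real ((cmod (h i j))\<^sup>2)"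
      unfolding complex_norm_square herm[symmetric]
      using minor[where i = i and j = i and k = j] by simp
    then have "of_real (Re (h j j) * Re (h i i)) = (of_real ((cmod (h i j))\<^sup>2) :: complex)"
      by (metis diag of_real_mult)
    then have "Re (h j j) * Re (h i i) = (cmod (h i j))\<^sup>2"
      unfolding of_real_eq_iff .
    then show ?thesis by (simp add: mult.commute)
  qed
  have tr': "(\<Sum>i\<in>UNIV. Re (h i i)) = 1" using arg_cong[OF tr, of Re] by simp
  obtain k where k: "Re (h k k) > 0"
  proof (rule ccontr)
    assume "\<not> thesis"
    then have "Re (h i i) \<le> 0" for i using that by (meson not_le)
    then have "(\<Sum>i\<in>UNIV. Re (h i i)) \<le> 0" by (simp add: sum_nonpos)
    with tr' show False by simp
  qed
  define z where "z i = h i k / of_real (sqrt (Re (h k k)))" for i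
  have "h i j = z i * cnj (z j)" for i j
  proof -
    have "z i * cnj (z j) = h i k * h k j / of_real (sqrt (Re (h k k)) * sqrt (Re (h k k)))"
      unfolding z_def
      by (simp only: complex_cnj_divide herm[symmetric] complex_cnj_complex_of_real of_real_mult
          times_divide_times_eq)
    also have "of_real (sqrt (Re (h k k)) * sqrt (Re (h k k))) = h k k"
      using k real_sqrt_mult_self[of "Re (h k k)"] by (simp only: abs_of_pos diag[symmetric])
    also have "h i k * h k j / h k k = h i j" using minor[of i k j] k by auto
    finally show ?thesis by simp
  qed
  then show thesis by (rule that)
qed

section \<open>Hopf coordinates on the nonnegative part of the unit 3-sphere\<close>

lemma polar_quarter:
  fixes x y :: real
  assumes "x \<ge> 0" "y \<ge> 0"
  obtains r u where "r \<ge> 0" "u \<in> {0..pi/2}" "x = r * sin u" "y = r * cos u"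
proof -
  define r where "r = sqrt (x\<^sup>2 + y\<^sup>2)"
  show thesis
  proof (cases "r = 0")
    case True
    \<comment> \<open>At the origin the angle is arbitrary; 0 is taken.\<close>
    then show thesis using that[of 0 0] by (simp add: r_def sum_power2_eq_zero_iff)
  next
    case False
    then have r: "r > 0" by (simp add: r_def less_le)
    have "(x / r)\<^sup>2 + (y / r)\<^sup>2 = 1"
      using r by (simp add: power_divide r_def flip: add_divide_distrib) (auto simp: sum_power2_gt_zero_iff)
    then obtain u where "0 \<le> u" "u \<le> pi / 2" "y / r = cos u" "x / r = sin u"
      using sincos_total_pi_half[of "y / r" "x / r"] assms r by (auto simp: add.commute)
    then show thesis using that[of r u] r by (simp add: field_simps)
  qed
qed

text \<open>Polar coordinates in the planes (a, b) and (c, d) give radii r and s with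
  \<open>s\<^sup>2 + r\<^sup>2 = 1\<close>, and these define the third angle.\<close>

lemma hopf_coordinates:
  fixes a b c d :: real
  assumes "a \<ge> 0" "b \<ge> 0" "c \<ge> 0" "d \<ge> 0" "a\<^sup>2 + b\<^sup>2 + c\<^sup>2 + d\<^sup>2 = 1"
  obtains u v w where "u \<in> {0..pi/2}" "v \<in> {0..pi/2}" "w \<in> {0..pi/2}"
    "a = sin u * sin v" "b = sin u * cos v" "c = cos u * sin w" "d = cos u * cos w"
proof -
  obtain r v where 1: "r \<ge> 0" "v \<in> {0..pi/2}" "a = r * sin v" "b = r * cos v"
    using polar_quarter assms by metis
  obtain s w where 2: "s \<ge> 0" "w \<in> {0..pi/2}" "c = s * sin w" "d = s * cos w"
    using polar_quarter assms by metis
  have "(r\<^sup>2) * ((sin v)\<^sup>2 + (cos v)\<^sup>2) + (s\<^sup>2) * ((sin w)\<^sup>2 + (cos w)\<^sup>2) = 1"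
    using assms(5) unfolding 1 2 by (simp only: power_mult_distrib distrib_left add.assoc)
  then have "s\<^sup>2 + r\<^sup>2 = 1" unfolding sin_cos_squared_add by simp
  then obtain u where "0 \<le> u" "u \<le> pi / 2" "s = cos u" "r = sin u"
    using sincos_total_pi_half[of s r] 1 2 by auto
  then show thesis using that[of u v w] 1 2 by simp
qed

lemma angle_in_period:
  obtains y where "y \<in> {0..2 * pi}" "cos y = cos x" "sin y = sin (x::real)"
  using sincos_total_2pi_le[of "cos x" "sin x"] by auto



section \<open>The Hermitian matrix built from the components\<close>

lemma vector_4 [simp]:
  "(vector [w, x, y, z] :: ('b::zero)^4) $ 1 = w" "(vector [w, x, y, z] :: ('b::zero)^4) $ 2 = x"
  "(vector [w, x, y, z] :: ('b::zero)^4) $ 3 = y" "(vector [w, x, y, z] :: ('b::zero)^4) $ 4 = z"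
  unfolding vector_def by simp_all

text \<open>
  Four times the Hermitian matrix. Rotating the coordinate planes \<open>(1,4)\<close>, \<open>(2,5)\<close>, \<open>(3,6)\<close> by
  \<open>\<phi>\<^sub>1, \<phi>\<^sub>2, \<phi>\<^sub>3\<close> multiplies the coordinates of \<open>z\<close> by phases, so that the off-diagonal entries carry
  the phases \<open>\<phi>\<^sub>i \<plusminus> \<phi>\<^sub>j\<close>.
\<close>
definition spinor_matrix :: "(6 \<Rightarrow> 6 \<Rightarrow> real) \<Rightarrow> complex^4^4" where
  "spinor_matrix a = vector
    [vector [Complex (1 + a 3 6 + a 1 4 + a 2 5) 0, Complex (a 4 5 - a 1 2) (a 1 5 - a 2 4),
       Complex (a 1 3 - a 4 6) (a 3 4 - a 1 6), Complex (a 2 6 - a 3 5) (a 2 3 - a 5 6)],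
     vector [Complex (a 4 5 - a 1 2) (a 2 4 - a 1 5), Complex (1 + a 3 6 - a 1 4 - a 2 5) 0,
       Complex (a 2 6 + a 3 5) (a 2 3 + a 5 6), Complex (a 1 3 + a 4 6) (- a 3 4 - a 1 6)],
     vector [Complex (a 1 3 - a 4 6) (a 1 6 - a 3 4), Complex (a 2 6 + a 3 5) (- a 2 3 - a 5 6),
       Complex (1 - a 3 6 - a 1 4 + a 2 5) 0, Complex (a 1 2 + a 4 5) (- a 1 5 - a 2 4)],
     vector [Complex (a 2 6 - a 3 5) (a 5 6 - a 2 3), Complex (a 1 3 + a 4 6) (a 3 4 + a 1 6),
       Complex (a 1 2 + a 4 5) (a 1 5 + a 2 4), Complex (1 - a 3 6 + a 1 4 - a 2 5) 0]]"

lemma spinor_matrix_hermitian: "spinor_matrix a $ j $ i = cnj (spinor_matrix a $ i $ j)"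
proof -
  have "\<forall>i j. spinor_matrix a $ j $ i = cnj (spinor_matrix a $ i $ j)"
    unfolding forall_4 spinor_matrix_def by (simp add: complex_eq_iff)
  then show ?thesis by blast
qed

text \<open>Real and imaginary parts of each minor are linear combinations of two kinds of quadratic
  relations: orthonormality of the rows of \<open>a\<close>, and the complementary
  Pfaffians.\<close>

lemma spinor_matrix_minors:
  fixes a :: "6 \<Rightarrow> 6 \<Rightarrow> real"
  assumes skew: "\<And>p q. a q p = - a p q"
    and orth: "\<And>p q. (\<Sum>r\<in>UNIV. a p r * a q r) = of_bool (p = q)"
    and pf: "pf6 a 1 2 3 4 5 6 = -1"
  shows "spinor_matrix a $ i $ k * spinor_matrix a $ k $ j
    = spinor_matrix a $ k $ k * spinor_matrix a $ i $ j"
proof -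
  note sk = skew_6[of a, OF skew]
  note pf = complementary_pf4[of a, OF skew orth pf, unfolded pf4_def]
  note orth = orth[unfolded sum_6]
  have Nd: "a 1 2 * a 1 2 + a 1 3 * a 1 3 + a 1 4 * a 1 4 + a 1 5 * a 1 5 + a 1 6 * a 1 6 = 1"
      "a 1 2 * a 1 2 + a 2 3 * a 2 3 + a 2 4 * a 2 4 + a 2 5 * a 2 5 + a 2 6 * a 2 6 = 1"
      "a 1 3 * a 1 3 + a 2 3 * a 2 3 + a 3 4 * a 3 4 + a 3 5 * a 3 5 + a 3 6 * a 3 6 = 1"
      "a 1 4 * a 1 4 + a 2 4 * a 2 4 + a 3 4 * a 3 4 + a 4 5 * a 4 5 + a 4 6 * a 4 6 = 1"
      "a 1 5 * a 1 5 + a 2 5 * a 2 5 + a 3 5 * a 3 5 + a 4 5 * a 4 5 + a 5 6 * a 5 6 = 1"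
      "a 1 6 * a 1 6 + a 2 6 * a 2 6 + a 3 6 * a 3 6 + a 4 6 * a 4 6 + a 5 6 * a 5 6 = 1"
    using orth[of 1 1] orth[of 2 2] orth[of 3 3] orth[of 4 4] orth[of 5 5] orth[of 6 6]
    by (simp_all add: sk)
  have N12: "a 1 3 * a 2 3 + a 1 4 * a 2 4 + a 1 5 * a 2 5 + a 1 6 * a 2 6 = 0"
      "a 1 4 * a 1 5 + a 2 4 * a 2 5 + a 3 4 * a 3 5 + a 4 6 * a 5 6 = 0"
      "a 1 2 * a 2 5 + a 1 3 * a 3 5 + a 1 4 * a 4 5 = a 1 6 * a 5 6"
      "a 1 2 * a 1 4 + a 2 5 * a 4 5 + a 2 6 * a 4 6 = a 2 3 * a 3 4"
    using orth[of 1 2] orth[of 4 5] orth[of 1 5] orth[of 2 4] by (simp_all add: sk algebra_simps)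
  have N13: "a 1 4 * a 3 4 + a 1 5 * a 3 5 + a 1 6 * a 3 6 = a 1 2 * a 2 3"
      "a 1 4 * a 1 6 + a 2 4 * a 2 6 + a 3 4 * a 3 6 = a 4 5 * a 5 6"
      "a 1 2 * a 2 6 + a 1 3 * a 3 6 + a 1 4 * a 4 6 + a 1 5 * a 5 6 = 0"
      "a 1 3 * a 1 4 + a 2 3 * a 2 4 + a 3 5 * a 4 5 + a 3 6 * a 4 6 = 0"
    using orth[of 1 3] orth[of 4 6] orth[of 1 6] orth[of 3 4] by (simp_all add: sk algebra_simps)
  have N23: "a 1 2 * a 1 3 + a 2 4 * a 3 4 + a 2 5 * a 3 5 + a 2 6 * a 3 6 = 0"
      "a 1 5 * a 1 6 + a 2 5 * a 2 6 + a 3 5 * a 3 6 + a 4 5 * a 4 6 = 0"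
      "a 2 3 * a 3 6 + a 2 4 * a 4 6 + a 2 5 * a 5 6 = a 1 2 * a 1 6"
      "a 1 3 * a 1 5 + a 2 3 * a 2 5 + a 3 6 * a 5 6 = a 3 4 * a 4 5"
    using orth[of 2 3] orth[of 5 6] orth[of 2 6] orth[of 3 5] by (simp_all add: sk algebra_simps)
  \<comment> \<open>The relations are grouped by the coordinate planes (1,4), (2,5), (3,6):
    \<open>Dd\<close> has the row norms and the Pfaffians belonging to these planes,
    \<open>D12\<close> the relations for one index from each of the first two planes, and so on.
    Each remaining goal follows linearly from a single group, with products of entries as
    atoms.\<close>
  note Dd = Nd[simplified algebra_simps] pf(3,8,12)[simplified algebra_simps]
  note D12 = N12[simplified algebra_simps] pf(1,4,7,13)[simplified algebra_simps]
  note D13 = N13[simplified algebra_simps] pf(2,5,10,14)[simplified algebra_simps]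
  note D23 = N23[simplified algebra_simps] pf(6,9,11,15)[simplified algebra_simps]
  have "\<forall>i k j. spinor_matrix a $ i $ k * spinor_matrix a $ k $ j
    = spinor_matrix a $ k $ k * spinor_matrix a $ i $ j"
    unfolding forall_4
    by (intro conjI; simp add: spinor_matrix_def complex_eq_iff; (intro conjI)?;
        (simp only: algebra_simps mult_minus_left mult_minus_right mult_1)?;
        (use Dd in linarith | use D12 in linarith | use D13 in linarith | use D23 in linarith))
  then show ?thesis by blast
qed

subsection \<open>The angles\<close>

text \<open>Only the products \<open>z i * cnj (z j)\<close> are given, so the phases of
  \<open>z\<close> enter through their differences; three of these are independent, one for each
  \<open>\<phi>\<^sub>i\<close>.\<close>

lemma spinor_angles:
  fixes a :: "6 \<Rightarrow> 6 \<Rightarrow> real" and z :: "4 \<Rightarrow> complex"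
  assumes z: "\<And>i j. spinor_matrix a $ i $ j = 4 * (z i * cnj (z j))"
  shows "\<exists>\<phi> \<in> {-pi/2..pi/2}. \<exists>\<psi> \<in> {-pi/2..pi/2}. \<exists>\<theta> \<in> {-pi/2..pi/2}.
      \<exists>\<phi>\<^sub>1 \<in> {0..2*pi}. \<exists>\<phi>\<^sub>2 \<in> {0..2*pi}. \<exists>\<phi>\<^sub>3 \<in> {0..2*pi}.
        let \<alpha> = (\<psi> + \<theta>) / 2; \<beta> = (\<psi> - \<theta>) / 2 in
          a 1 2 = sin \<alpha> * sin \<beta> * (cos \<phi>\<^sub>1 * cos \<phi>\<^sub>2 - sin \<phi> * sin \<phi>\<^sub>1 * sin \<phi>\<^sub>2)
              + cos \<alpha> * cos \<beta> * (sin \<phi>\<^sub>1 * sin \<phi>\<^sub>2 - sin \<phi> * cos \<phi>\<^sub>1 * cos \<phi>\<^sub>2) \<and>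
          a 1 3 = cos \<phi> * (cos \<beta> * cos \<phi>\<^sub>1 * cos \<phi>\<^sub>3 - sin \<alpha> * sin \<phi>\<^sub>1 * sin \<phi>\<^sub>3) \<and>
          a 1 4 = sin \<phi> * sin \<alpha> * cos \<beta> + cos \<alpha> * sin \<beta> \<and>
          a 1 5 = cos \<alpha> * cos \<beta> * (sin \<phi> * cos \<phi>\<^sub>1 * sin \<phi>\<^sub>2 + sin \<phi>\<^sub>1 * cos \<phi>\<^sub>2)
              - sin \<alpha> * sin \<beta> * (sin \<phi> * sin \<phi>\<^sub>1 * cos \<phi>\<^sub>2 + cos \<phi>\<^sub>1 * sin \<phi>\<^sub>2) \<and>
          a 1 6 = - cos \<phi> * (sin \<alpha> * sin \<phi>\<^sub>1 * cos \<phi>\<^sub>3 + cos \<beta> * cos \<phi>\<^sub>1 * sin \<phi>\<^sub>3) \<and>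
          a 2 3 = cos \<phi> * (cos \<alpha> * cos \<phi>\<^sub>2 * sin \<phi>\<^sub>3 + sin \<beta> * sin \<phi>\<^sub>2 * cos \<phi>\<^sub>3) \<and>
          a 2 4 = sin \<alpha> * sin \<beta> * (sin \<phi>\<^sub>1 * cos \<phi>\<^sub>2 + sin \<phi> * cos \<phi>\<^sub>1 * sin \<phi>\<^sub>2)
              - cos \<alpha> * cos \<beta> * (sin \<phi> * sin \<phi>\<^sub>1 * cos \<phi>\<^sub>2 + cos \<phi>\<^sub>1 * sin \<phi>\<^sub>2) \<and>
          a 2 5 = sin \<phi> * cos \<alpha> * sin \<beta> + cos \<beta> * sin \<alpha> \<and>
          a 2 6 = cos \<phi> * (cos \<alpha> * cos \<phi>\<^sub>2 * cos \<phi>\<^sub>3 - sin \<beta> * sin \<phi>\<^sub>2 * sin \<phi>\<^sub>3) \<and>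
          a 3 4 = cos \<phi> * (sin \<alpha> * cos \<phi>\<^sub>1 * sin \<phi>\<^sub>3 + cos \<beta> * sin \<phi>\<^sub>1 * cos \<phi>\<^sub>3) \<and>
          a 3 5 = cos \<phi> * (cos \<alpha> * sin \<phi>\<^sub>2 * sin \<phi>\<^sub>3 - sin \<beta> * cos \<phi>\<^sub>2 * cos \<phi>\<^sub>3) \<and>
          a 3 6 = sin \<phi> \<and>
          a 4 5 = cos \<alpha> * cos \<beta> * (cos \<phi>\<^sub>1 * cos \<phi>\<^sub>2 - sin \<phi> * sin \<phi>\<^sub>1 * sin \<phi>\<^sub>2)
              - sin \<alpha> * sin \<beta> * (sin \<phi> * cos \<phi>\<^sub>1 * cos \<phi>\<^sub>2 - sin \<phi>\<^sub>1 * sin \<phi>\<^sub>2) \<and>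
          a 4 6 = cos \<phi> * (cos \<beta> * sin \<phi>\<^sub>1 * sin \<phi>\<^sub>3 - sin \<alpha> * cos \<phi>\<^sub>1 * cos \<phi>\<^sub>3) \<and>
          a 5 6 = - cos \<phi> * (cos \<alpha> * sin \<phi>\<^sub>2 * cos \<phi>\<^sub>3 + sin \<beta> * cos \<phi>\<^sub>2 * sin \<phi>\<^sub>3)"
proof -
  \<comment> \<open>Where \<open>z i\<close> is zero the argument is a default value, made harmless
    by the factor \<open>cmod (z i)\<close>.\<close>
  define t where "t i = Arg (z i)" for i
  have zcis: "z i = of_real (cmod (z i)) * cis (t i)" for i
    using rcis_cmod_Arg[of "z i"] by (simp add: rcis_def t_def)
  have h: "spinor_matrix a $ i $ j = of_real (4 * (cmod (z i) * cmod (z j))) * cis (t i - t j)" for i j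
    unfolding z by (subst zcis[of i], subst zcis[of j])
      (simp add: cis_cnj cis_mult[symmetric] cis_divide[symmetric] divide_inverse)
  have hRe: "Re (spinor_matrix a $ i $ j) = 4 * (cmod (z i) * cmod (z j)) * cos (t i - t j)"
    and hIm: "Im (spinor_matrix a $ i $ j) = 4 * (cmod (z i) * cmod (z j)) * sin (t i - t j)" for i j
    unfolding h by simp_all
  have d: "1 + a 3 6 + a 1 4 + a 2 5 = 4 * (cmod (z 1))\<^sup>2" "1 + a 3 6 - a 1 4 - a 2 5 = 4 * (cmod (z 2))\<^sup>2"
    "1 - a 3 6 - a 1 4 + a 2 5 = 4 * (cmod (z 3))\<^sup>2" "1 - a 3 6 + a 1 4 - a 2 5 = 4 * (cmod (z 4))\<^sup>2"
    using hRe[of 1 1] hRe[of 2 2] hRe[of 3 3] hRe[of 4 4]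
    by (simp_all add: spinor_matrix_def power2_eq_square)
  have "(cmod (z 1))\<^sup>2 + (cmod (z 2))\<^sup>2 + (cmod (z 3))\<^sup>2 + (cmod (z 4))\<^sup>2 = 1"
    using d by linarith
  then obtain u v w where uvw: "u \<in> {0..pi/2}" "v \<in> {0..pi/2}" "w \<in> {0..pi/2}"
    and m: "cmod (z 1) = sin u * sin v" "cmod (z 2) = sin u * cos v"
      "cmod (z 3) = cos u * sin w" "cmod (z 4) = cos u * cos w"
    using hopf_coordinates[of "cmod (z 1)" "cmod (z 2)" "cmod (z 3)" "cmod (z 4)"] by auto
  \<comment> \<open>The half-sums are chosen so that t1 - t2 = f1 + f2, t4 - t3 = f1 - f2 and so on,
    up to periods. Their sign patterns are those expressing \<open>a 1 4\<close>,
    \<open>a 2 5\<close>, \<open>a 3 6\<close> through the squared moduli of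
    \<open>z\<close>.\<close>
  obtain f1 where f1: "f1 \<in> {0..2 * pi}" "cos f1 = cos ((t 1 - t 2 - t 3 + t 4) / 2)"
      "sin f1 = sin ((t 1 - t 2 - t 3 + t 4) / 2)"
    by (rule angle_in_period)
  obtain f2 where f2: "f2 \<in> {0..2 * pi}" "cos f2 = cos ((t 1 - t 2 + t 3 - t 4) / 2)"
      "sin f2 = sin ((t 1 - t 2 + t 3 - t 4) / 2)"
    by (rule angle_in_period)
  obtain f3 where f3: "f3 \<in> {0..2 * pi}" "cos f3 = cos ((t 1 + t 2 - t 3 - t 4) / 2)"
      "sin f3 = sin ((t 1 + t 2 - t 3 - t 4) / 2)"
    by (rule angle_in_period)
  have tt: "cos (t 1 - t 2) = cos f1 * cos f2 - sin f1 * sin f2"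
    "sin (t 1 - t 2) = sin f1 * cos f2 + cos f1 * sin f2"
    "cos (t 1 - t 3) = cos f1 * cos f3 - sin f1 * sin f3"
    "sin (t 1 - t 3) = sin f1 * cos f3 + cos f1 * sin f3"
    "cos (t 1 - t 4) = cos f2 * cos f3 - sin f2 * sin f3"
    "sin (t 1 - t 4) = sin f2 * cos f3 + cos f2 * sin f3"
    "cos (t 4 - t 3) = cos f1 * cos f2 + sin f1 * sin f2"
    "sin (t 4 - t 3) = sin f1 * cos f2 - cos f1 * sin f2"
    "cos (t 4 - t 2) = cos f1 * cos f3 + sin f1 * sin f3"
    "sin (t 4 - t 2) = sin f1 * cos f3 - cos f1 * sin f3"
    "cos (t 3 - t 2) = cos f2 * cos f3 + sin f2 * sin f3"
    "sin (t 3 - t 2) = sin f2 * cos f3 - cos f2 * sin f3"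
    unfolding f1 f2 f3 cos_add[symmetric] cos_diff[symmetric] sin_add[symmetric] sin_diff[symmetric]
    by (auto intro!: arg_cong[where f = cos] arg_cong[where f = sin] simp: field_simps)
  \<comment> \<open>Doubling and shifting carries [0, pi/2] onto [-pi/2, pi/2]. It fits because
    \<open>a 3 6\<close> is the difference of the squared radii,
    \<open>(sin u)\<^sup>2 - (cos u)\<^sup>2\<close>, which equals
    \<open>sin \<phi>\<close>.\<close>
  define \<phi> \<psi> \<theta> where "\<phi> = 2 * u - pi / 2" and "\<psi> = 2 * v - pi / 2" and "\<theta> = 2 * w - pi / 2"
  define \<alpha> \<beta> where "\<alpha> = (\<psi> + \<theta>) / 2" and "\<beta> = (\<psi> - \<theta>) / 2"
  have \<alpha>': "\<alpha> = v + w - pi / 2" and \<beta>': "\<beta> = v - w"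
    by (simp_all add: \<alpha>_def \<beta>_def \<psi>_def \<theta>_def field_simps)
  have trig: "sin \<phi> = (sin u)\<^sup>2 - (cos u)\<^sup>2" "cos \<phi> = 2 * sin u * cos u"
      "sin \<alpha> = sin v * sin w - cos v * cos w" "cos \<alpha> = sin v * cos w + cos v * sin w"
      "sin \<beta> = sin v * cos w - cos v * sin w" "cos \<beta> = cos v * cos w + sin v * sin w"
    unfolding \<alpha>' \<beta>' \<phi>_def
    by (simp_all add: sin_diff cos_diff cos_double sin_double cos_add sin_add)
  have pyth: "(sin u)\<^sup>2 + (cos u)\<^sup>2 = 1" "(sin v)\<^sup>2 + (cos v)\<^sup>2 = 1" "(sin w)\<^sup>2 + (cos w)\<^sup>2 = 1"
    by simp_all
  \<comment> \<open>Both parts of six off-diagonal entries; the index orders (4,3), (4,2), (3,2)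
    match the phase differences in \<open>tt\<close>.\<close>
  have off: "a 4 5 - a 1 2 = 4 * (sin u * sin v * (sin u * cos v)) * (cos f1 * cos f2 - sin f1 * sin f2)"
    "a 1 5 - a 2 4 = 4 * (sin u * sin v * (sin u * cos v)) * (sin f1 * cos f2 + cos f1 * sin f2)"
    "a 1 3 - a 4 6 = 4 * (sin u * sin v * (cos u * sin w)) * (cos f1 * cos f3 - sin f1 * sin f3)"
    "a 3 4 - a 1 6 = 4 * (sin u * sin v * (cos u * sin w)) * (sin f1 * cos f3 + cos f1 * sin f3)"
    "a 2 6 - a 3 5 = 4 * (sin u * sin v * (cos u * cos w)) * (cos f2 * cos f3 - sin f2 * sin f3)"
    "a 2 3 - a 5 6 = 4 * (sin u * sin v * (cos u * cos w)) * (sin f2 * cos f3 + cos f2 * sin f3)"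
    "a 1 2 + a 4 5 = 4 * (cos u * cos w * (cos u * sin w)) * (cos f1 * cos f2 + sin f1 * sin f2)"
    "a 1 5 + a 2 4 = 4 * (cos u * cos w * (cos u * sin w)) * (sin f1 * cos f2 - cos f1 * sin f2)"
    "a 1 3 + a 4 6 = 4 * (cos u * cos w * (sin u * cos v)) * (cos f1 * cos f3 + sin f1 * sin f3)"
    "a 3 4 + a 1 6 = 4 * (cos u * cos w * (sin u * cos v)) * (sin f1 * cos f3 - cos f1 * sin f3)"
    "a 2 6 + a 3 5 = 4 * (cos u * sin w * (sin u * cos v)) * (cos f2 * cos f3 + sin f2 * sin f3)"
    "- a 2 3 - a 5 6 = 4 * (cos u * sin w * (sin u * cos v)) * (sin f2 * cos f3 - cos f2 * sin f3)"
    using hRe[of 1 2] hIm[of 1 2] hRe[of 1 3] hIm[of 1 3] hRe[of 1 4] hIm[of 1 4]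
      hRe[of 4 3] hIm[of 4 3] hRe[of 4 2] hIm[of 4 2] hRe[of 3 2] hIm[of 3 2]
    unfolding m tt spinor_matrix_def by (simp_all only: vector_4 complex.sel)
  note d = d[unfolded m power_mult_distrib]
  show ?thesis
  proof (rule bexI[of _ \<phi>], rule bexI[of _ \<psi>], rule bexI[of _ \<theta>],
      rule bexI[of _ f1], rule bexI[of _ f2], rule bexI[of _ f3])
    show "\<phi> \<in> {-pi/2..pi/2}" "\<psi> \<in> {-pi/2..pi/2}" "\<theta> \<in> {-pi/2..pi/2}"
      using uvw by (simp_all add: \<phi>_def \<psi>_def \<theta>_def)
    show "f1 \<in> {0..2*pi}" "f2 \<in> {0..2*pi}" "f3 \<in> {0..2*pi}" by fact+
    show "let \<alpha> = (\<psi> + \<theta>) / 2; \<beta> = (\<psi> - \<theta>) / 2 in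
          a 1 2 = sin \<alpha> * sin \<beta> * (cos f1 * cos f2 - sin \<phi> * sin f1 * sin f2)
              + cos \<alpha> * cos \<beta> * (sin f1 * sin f2 - sin \<phi> * cos f1 * cos f2) \<and>
          a 1 3 = cos \<phi> * (cos \<beta> * cos f1 * cos f3 - sin \<alpha> * sin f1 * sin f3) \<and>
          a 1 4 = sin \<phi> * sin \<alpha> * cos \<beta> + cos \<alpha> * sin \<beta> \<and>
          a 1 5 = cos \<alpha> * cos \<beta> * (sin \<phi> * cos f1 * sin f2 + sin f1 * cos f2)
              - sin \<alpha> * sin \<beta> * (sin \<phi> * sin f1 * cos f2 + cos f1 * sin f2) \<and>
          a 1 6 = - cos \<phi> * (sin \<alpha> * sin f1 * cos f3 + cos \<beta> * cos f1 * sin f3) \<and>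
          a 2 3 = cos \<phi> * (cos \<alpha> * cos f2 * sin f3 + sin \<beta> * sin f2 * cos f3) \<and>
          a 2 4 = sin \<alpha> * sin \<beta> * (sin f1 * cos f2 + sin \<phi> * cos f1 * sin f2)
              - cos \<alpha> * cos \<beta> * (sin \<phi> * sin f1 * cos f2 + cos f1 * sin f2) \<and>
          a 2 5 = sin \<phi> * cos \<alpha> * sin \<beta> + cos \<beta> * sin \<alpha> \<and>
          a 2 6 = cos \<phi> * (cos \<alpha> * cos f2 * cos f3 - sin \<beta> * sin f2 * sin f3) \<and>
          a 3 4 = cos \<phi> * (sin \<alpha> * cos f1 * sin f3 + cos \<beta> * sin f1 * cos f3) \<and>
          a 3 5 = cos \<phi> * (cos \<alpha> * sin f2 * sin f3 - sin \<beta> * cos f2 * cos f3) \<and>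
          a 3 6 = sin \<phi> \<and>
          a 4 5 = cos \<alpha> * cos \<beta> * (cos f1 * cos f2 - sin \<phi> * sin f1 * sin f2)
              - sin \<alpha> * sin \<beta> * (sin \<phi> * cos f1 * cos f2 - sin f1 * sin f2) \<and>
          a 4 6 = cos \<phi> * (cos \<beta> * sin f1 * sin f3 - sin \<alpha> * cos f1 * cos f3) \<and>
          a 5 6 = - cos \<phi> * (cos \<alpha> * sin f2 * cos f3 + sin \<beta> * cos f2 * sin f3)"
      unfolding Let_def \<alpha>_def[symmetric] \<beta>_def[symmetric]
    proof (intro conjI)
      \<comment> \<open>Each component outside the three planes is half the sum or difference of two
        equations in \<open>off\<close>. Here \<open>pyth\<close> yields sin \<alpha> sin \<beta> =
        sin w cos w - sin v cos v and cos \<alpha> cos \<beta> = sin v cos v + sin w cos w, while 1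
        + sin \<phi> and 1 - sin \<phi> are twice the squares of sin u and cos u.\<close>
      show "a 1 2 = sin \<alpha> * sin \<beta> * (cos f1 * cos f2 - sin \<phi> * sin f1 * sin f2)
          + cos \<alpha> * cos \<beta> * (sin f1 * sin f2 - sin \<phi> * cos f1 * cos f2)"
        using off(1,7) pyth unfolding trig by algebra
      show "a 1 3 = cos \<phi> * (cos \<beta> * cos f1 * cos f3 - sin \<alpha> * sin f1 * sin f3)"
        using off(3,9) unfolding trig by algebra
      \<comment> \<open>The components 14, 25 and 36 are signed sums of the four diagonal equations
        \<open>d\<close>.\<close>
      show "a 1 4 = sin \<phi> * sin \<alpha> * cos \<beta> + cos \<alpha> * sin \<beta>"
        using d pyth unfolding trig by algebra
      show "a 1 5 = cos \<alpha> * cos \<beta> * (sin \<phi> * cos f1 * sin f2 + sin f1 * cos f2)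
          - sin \<alpha> * sin \<beta> * (sin \<phi> * sin f1 * cos f2 + cos f1 * sin f2)"
        using off(2,8) pyth unfolding trig by algebra
      show "a 1 6 = - cos \<phi> * (sin \<alpha> * sin f1 * cos f3 + cos \<beta> * cos f1 * sin f3)"
        using off(4,10) unfolding trig by algebra
      show "a 2 3 = cos \<phi> * (cos \<alpha> * cos f2 * sin f3 + sin \<beta> * sin f2 * cos f3)"
        using off(6,12) unfolding trig by algebra
      show "a 2 4 = sin \<alpha> * sin \<beta> * (sin f1 * cos f2 + sin \<phi> * cos f1 * sin f2)
          - cos \<alpha> * cos \<beta> * (sin \<phi> * sin f1 * cos f2 + cos f1 * sin f2)"
        using off(2,8) pyth unfolding trig by algebra
      show "a 2 5 = sin \<phi> * cos \<alpha> * sin \<beta> + cos \<beta> * sin \<alpha>"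
        using d pyth unfolding trig by algebra
      show "a 2 6 = cos \<phi> * (cos \<alpha> * cos f2 * cos f3 - sin \<beta> * sin f2 * sin f3)"
        using off(5,11) unfolding trig by algebra
      show "a 3 4 = cos \<phi> * (sin \<alpha> * cos f1 * sin f3 + cos \<beta> * sin f1 * cos f3)"
        using off(4,10) unfolding trig by algebra
      show "a 3 5 = cos \<phi> * (cos \<alpha> * sin f2 * sin f3 - sin \<beta> * cos f2 * cos f3)"
        using off(5,11) unfolding trig by algebra
      show "a 3 6 = sin \<phi>"
        using d pyth unfolding trig by algebra
      show "a 4 5 = cos \<alpha> * cos \<beta> * (cos f1 * cos f2 - sin \<phi> * sin f1 * sin f2)
          - sin \<alpha> * sin \<beta> * (sin \<phi> * cos f1 * cos f2 - sin f1 * sin f2)"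
        using off(1,7) pyth unfolding trig by algebra
      show "a 4 6 = cos \<phi> * (cos \<beta> * sin f1 * sin f3 - sin \<alpha> * cos f1 * cos f3)"
        using off(3,9) unfolding trig by algebra
      show "a 5 6 = - cos \<phi> * (cos \<alpha> * sin f2 * cos f3 + sin \<beta> * cos f2 * sin f3)"
        using off(6,12) unfolding trig by algebra
    qed
  qed
qed

theorem corollary2:
  fixes br :: "'a::euclidean_space \<Rightarrow> 'a \<Rightarrow> 'a"
    and e :: "6 \<Rightarrow> 'a"
    and I0 J :: "'a \<Rightarrow> 'a"
  assumes "DIM('a) = 6"
    and "lie_bracket br"
    and "orthonormal_basis e"
    and "almost_complex I0"
    and "I0 (e 1) = e 4" and "I0 (e 2) = e 5" and "I0 (e 3) = e 6"
    and "J \<in> acs_orbit e I0"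
  shows "\<exists>\<phi> \<in> {-pi/2..pi/2}. \<exists>\<psi> \<in> {-pi/2..pi/2}. \<exists>\<theta> \<in> {-pi/2..pi/2}.
      \<exists>\<phi>\<^sub>1 \<in> {0..2*pi}. \<exists>\<phi>\<^sub>2 \<in> {0..2*pi}. \<exists>\<phi>\<^sub>3 \<in> {0..2*pi}.
        let \<alpha> = (\<psi> + \<theta>) / 2; \<beta> = (\<psi> - \<theta>) / 2; Jc = (\<lambda>i j. J (e i) \<bullet> e j) in
          (\<forall>i j. Jc j i = - Jc i j) \<and>
          Jc 1 2 = sin \<alpha> * sin \<beta> * (cos \<phi>\<^sub>1 * cos \<phi>\<^sub>2 - sin \<phi> * sin \<phi>\<^sub>1 * sin \<phi>\<^sub>2)
              + cos \<alpha> * cos \<beta> * (sin \<phi>\<^sub>1 * sin \<phi>\<^sub>2 - sin \<phi> * cos \<phi>\<^sub>1 * cos \<phi>\<^sub>2) \<and>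
          Jc 1 3 = cos \<phi> * (cos \<beta> * cos \<phi>\<^sub>1 * cos \<phi>\<^sub>3 - sin \<alpha> * sin \<phi>\<^sub>1 * sin \<phi>\<^sub>3) \<and>
          Jc 1 4 = sin \<phi> * sin \<alpha> * cos \<beta> + cos \<alpha> * sin \<beta> \<and>
          Jc 1 5 = cos \<alpha> * cos \<beta> * (sin \<phi> * cos \<phi>\<^sub>1 * sin \<phi>\<^sub>2 + sin \<phi>\<^sub>1 * cos \<phi>\<^sub>2)
              - sin \<alpha> * sin \<beta> * (sin \<phi> * sin \<phi>\<^sub>1 * cos \<phi>\<^sub>2 + cos \<phi>\<^sub>1 * sin \<phi>\<^sub>2) \<and>
          Jc 1 6 = - cos \<phi> * (sin \<alpha> * sin \<phi>\<^sub>1 * cos \<phi>\<^sub>3 + cos \<beta> * cos \<phi>\<^sub>1 * sin \<phi>\<^sub>3) \<and>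
          Jc 2 3 = cos \<phi> * (cos \<alpha> * cos \<phi>\<^sub>2 * sin \<phi>\<^sub>3 + sin \<beta> * sin \<phi>\<^sub>2 * cos \<phi>\<^sub>3) \<and>
          Jc 2 4 = sin \<alpha> * sin \<beta> * (sin \<phi>\<^sub>1 * cos \<phi>\<^sub>2 + sin \<phi> * cos \<phi>\<^sub>1 * sin \<phi>\<^sub>2)
              - cos \<alpha> * cos \<beta> * (sin \<phi> * sin \<phi>\<^sub>1 * cos \<phi>\<^sub>2 + cos \<phi>\<^sub>1 * sin \<phi>\<^sub>2) \<and>
          Jc 2 5 = sin \<phi> * cos \<alpha> * sin \<beta> + cos \<beta> * sin \<alpha> \<and>
          Jc 2 6 = cos \<phi> * (cos \<alpha> * cos \<phi>\<^sub>2 * cos \<phi>\<^sub>3 - sin \<beta> * sin \<phi>\<^sub>2 * sin \<phi>\<^sub>3) \<and>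
          Jc 3 4 = cos \<phi> * (sin \<alpha> * cos \<phi>\<^sub>1 * sin \<phi>\<^sub>3 + cos \<beta> * sin \<phi>\<^sub>1 * cos \<phi>\<^sub>3) \<and>
          Jc 3 5 = cos \<phi> * (cos \<alpha> * sin \<phi>\<^sub>2 * sin \<phi>\<^sub>3 - sin \<beta> * cos \<phi>\<^sub>2 * cos \<phi>\<^sub>3) \<and>
          Jc 3 6 = sin \<phi> \<and>
          Jc 4 5 = cos \<alpha> * cos \<beta> * (cos \<phi>\<^sub>1 * cos \<phi>\<^sub>2 - sin \<phi> * sin \<phi>\<^sub>1 * sin \<phi>\<^sub>2)
              - sin \<alpha> * sin \<beta> * (sin \<phi> * cos \<phi>\<^sub>1 * cos \<phi>\<^sub>2 - sin \<phi>\<^sub>1 * sin \<phi>\<^sub>2) \<and>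
          Jc 4 6 = cos \<phi> * (cos \<beta> * sin \<phi>\<^sub>1 * sin \<phi>\<^sub>3 - sin \<alpha> * cos \<phi>\<^sub>1 * cos \<phi>\<^sub>3) \<and>
          Jc 5 6 = - cos \<phi> * (cos \<alpha> * sin \<phi>\<^sub>2 * cos \<phi>\<^sub>3 + sin \<beta> * cos \<phi>\<^sub>2 * sin \<phi>\<^sub>3)"
proof -
  define a where "a = (\<lambda>i j. J (e i) \<bullet> e j)"
  have oJ: "orthogonal_acs J"
    using standard_acs_orthogonal assms acs_orbit_orthogonal by blast
  have skew: "a q p = - a p q" for p q
    unfolding a_def by (rule orthogonal_acs_skew[OF oJ])
  have orth: "(\<Sum>r\<in>UNIV. a p r * a q r) = of_bool (p = q)" for p q
    using oJ assms(3) unfolding a_def orthonormal_basis_inner[OF assms(3)]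
    by (simp add: orthogonal_acs_def orthonormal_basis_def)
  have pf: "pf6 a 1 2 3 4 5 6 = -1"
    unfolding a_def by (rule acs_orbit_pfaffian) fact+
  note minors = spinor_matrix_minors[of a, OF skew orth pf]
  \<comment> \<open>The diagonal entries of \<open>spinor_matrix a\<close> add up to 4, so division
    by 4 normalises the trace to 1.\<close>
  obtain z where z: "spinor_matrix a $ i $ j / 4 = z i * cnj (z j)" for i j
  proof (rule rank_one_hermitian[of "\<lambda>i j. spinor_matrix a $ i $ j / 4"])
    show "spinor_matrix a $ j $ i / 4 = cnj (spinor_matrix a $ i $ j / 4)" for i j
      using spinor_matrix_hermitian[of a j i] by simp
    show "(\<Sum>i\<in>UNIV. spinor_matrix a $ i $ i / 4) = 1"
      unfolding sum_4 by (simp add: spinor_matrix_def complex_eq_iff field_simps)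
    show "spinor_matrix a $ i $ k / 4 * (spinor_matrix a $ k $ j / 4)
        = spinor_matrix a $ k $ k / 4 * (spinor_matrix a $ i $ j / 4)" for i j k
      using minors[of i k j] by simp
  qed (rule that)
  have "spinor_matrix a $ i $ j = 4 * (z i * cnj (z j))" for i j
    using z[of i j] by (simp add: field_simps)
  from spinor_angles[OF this] show ?thesis
    using skew unfolding a_def Let_def by blast
qed

end
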